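(* Let $a<b$ be real numbers and let $f:[a,b]\to\overline{\mathbb{R}}$ be Lebesgue-integrable. Then $$m\left(\left\{c\in(a,b)\,:\, f(c)(b-a)\le\int_a^b f(x)\,dx\right\}\right)>0$$ and $$m\left(\left\{c\in(a,b)\,:\, \int_a^b f(x)\,dx\le f(c)(b-a)\right\}\right)>0.$$
   Context: $m$ denotes the Lebesgue measure in $\mathbb{R}$, and $\overline{\mathbb{R}}=[-\infty,+\infty]$ is the extended real line. Lebesgue-integrable means that $f$ is Lebesgue measurable and $\int_a^b |f(x)|\,dx<\infty$. Integrals are Lebesgue integrals. *)

theory Defs
  imports "HOL-Analysis.Analysis"
begin

text \<open>
  The library's Bochner integral covers real-valued functions and the
  nonnegative integral covers \<^typ>\<open>ennreal\<close>-valued ones; the two definitions below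
  give the usual integral of functions with values in the extended real line.
  Note that \<^term>\<open>e2ennreal y\<close> truncates negative \<^term>\<open>y\<close> to 0, so
  \<^term>\<open>\<lambda>x. e2ennreal (f x)\<close> and \<^term>\<open>\<lambda>x. e2ennreal (- f x)\<close> are the positive and the
  negative part of \<^term>\<open>f\<close>.
\<close>

definition ext_integrable :: "'a measure \<Rightarrow> ('a \<Rightarrow> ereal) \<Rightarrow> bool" where
  "ext_integrable M f \<longleftrightarrow>
     f \<in> borel_measurable M \<and> (\<integral>\<^sup>+ x. e2ennreal \<bar>f x\<bar> \<partial>M) < \<infinity>"

definition ext_integral :: "'a measure \<Rightarrow> ('a \<Rightarrow> ereal) \<Rightarrow> ereal" where
  "ext_integral M f =
     enn2ereal (\<integral>\<^sup>+ x. e2ennreal (f x) \<partial>M) - enn2ereal (\<integral>\<^sup>+ x. e2ennreal (- f x) \<partial>M)"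

lemma ext_integrable_ereal:
  "ext_integrable M (\<lambda>x. ereal (g x)) \<longleftrightarrow> integrable M g"
  unfolding ext_integrable_def integrable_iff_bounded
  by (simp add: e2ennreal_ereal borel_measurable_ereal_iff)

lemma ext_integral_ereal:
  assumes "integrable M g"
  shows "ext_integral M (\<lambda>x. ereal (g x)) = ereal (integral\<^sup>L M g)"
proof -
  have fin: "(\<integral>\<^sup>+ x. ennreal (g x) \<partial>M) \<noteq> \<infinity>" "(\<integral>\<^sup>+ x. ennreal (- g x) \<partial>M) \<noteq> \<infinity>"
    using assms by (auto simp: real_integrable_def)
  then obtain p n where "(\<integral>\<^sup>+ x. ennreal (g x) \<partial>M) = ennreal p" "0 \<le> p"
      "(\<integral>\<^sup>+ x. ennreal (- g x) \<partial>M) = ennreal n" "0 \<le> n"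
    by (metis ennreal_cases infinity_ennreal_def)
  then show ?thesis
    using assms by (simp add: ext_integral_def real_lebesgue_integral_def e2ennreal_ereal)
qed

end

theory Submission
  imports Defs
begin

text \<open>
  An integrable function is almost everywhere finite, so it may be replaced by a real-valued
  one. If one of the two sets were null, then \<open>f c * (b - a)\<close> would lie strictly on one side of
  the integral for almost every \<open>c\<close>, and integrating this strict inequality over \<open>{a..b}\<close> would
  give that \<open>b - a\<close> times the integral is strictly smaller than itself.
\<close>

text \<open>A finite integral of the absolute value forces \<open>f\<close> to be finite almost
  everywhere, and at a finite value \<open>real_of_ereal\<close> loses nothing. At infinite values
  it returns 0, so the equation fails exactly there.\<close>

lemma ext_integrable_AE_real:
  assumes "ext_integrable M f"
  shows "AE x in M. f x = ereal (real_of_ereal (f x))"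
proof -
  have [measurable]: "f \<in> borel_measurable M"
    and fin: "(\<integral>\<^sup>+ x. e2ennreal \<bar>f x\<bar> \<partial>M) \<noteq> \<infinity>"
    using assms by (auto simp: ext_integrable_def)
  have "AE x in M. e2ennreal \<bar>f x\<bar> \<noteq> \<infinity>"
    using fin by (intro nn_integral_PInf_AE) auto
  then show ?thesis
  proof eventually_elim
    case (elim x)
    then show ?case by (cases "f x") auto
  qed
qed

lemma ext_integrable_cong_AE:
  assumes "f \<in> borel_measurable M" "g \<in> borel_measurable M" "AE x in M. f x = g x"
  shows "ext_integrable M f \<longleftrightarrow> ext_integrable M g"
proof -
  have "(\<integral>\<^sup>+ x. e2ennreal \<bar>f x\<bar> \<partial>M) = (\<integral>\<^sup>+ x. e2ennreal \<bar>g x\<bar> \<partial>M)"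
    using assms(3) by (intro nn_integral_cong_AE) auto
  with assms(1,2) show ?thesis by (simp add: ext_integrable_def)
qed

lemma ext_integral_cong_AE:
  assumes "AE x in M. f x = g x"
  shows "ext_integral M f = ext_integral M g"
proof -
  have "(\<integral>\<^sup>+ x. e2ennreal (f x) \<partial>M) = (\<integral>\<^sup>+ x. e2ennreal (g x) \<partial>M)"
    "(\<integral>\<^sup>+ x. e2ennreal (- f x) \<partial>M) = (\<integral>\<^sup>+ x. e2ennreal (- g x) \<partial>M)"
    using assms by (auto intro!: nn_integral_cong_AE)
  then show ?thesis by (simp add: ext_integral_def)
qed

context finite_measure
begin

text \<open>Over a finite measure the constant on the left and the function on the right have the
  same integral. On a space of nonzero mass, a strict inequality almost everywhere would separate
  these integrals.\<close>

lemma not_AE_integral_less: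
  fixes g :: "'a \<Rightarrow> real"
  assumes "integrable M g" "emeasure M (space M) \<noteq> 0"
  shows "\<not> (AE x in M. integral\<^sup>L M g < g x * measure M (space M))"
proof
  assume "AE x in M. integral\<^sup>L M g < g x * measure M (space M)"
  then have "(\<integral>x. integral\<^sup>L M g \<partial>M) < (\<integral>x. g x * measure M (space M) \<partial>M)"
    using assms by (intro integral_less_AE_space) auto
  then show False by (simp add: mult.commute)
qed

lemma ext_integral_not_AE_less:
  assumes f: "ext_integrable M f" and pos: "emeasure M (space M) \<noteq> 0"
  shows "\<not> (AE x in M. ext_integral M f < f x * ereal (measure M (space M)))"
    and "\<not> (AE x in M. f x * ereal (measure M (space M)) < ext_integral M f)"
proof -
  define g where "g = (\<lambda>x. real_of_ereal (f x))"
  have meas: "f \<in> borel_measurable M" using f by (simp add: ext_integrable_def)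
  have fg: "AE x in M. f x = ereal (g x)"
    using ext_integrable_AE_real[OF f] by (simp add: g_def)
  have "g \<in> borel_measurable M" using meas by (simp add: g_def)
  then have g: "integrable M g"
    using ext_integrable_cong_AE[OF meas _ fg] f by (simp add: ext_integrable_ereal)
  have I: "ext_integral M f = ereal (integral\<^sup>L M g)"
    using ext_integral_cong_AE[OF fg] ext_integral_ereal[OF g] by simp
  show "\<not> (AE x in M. ext_integral M f < f x * ereal (measure M (space M)))"
  proof
    assume "AE x in M. ext_integral M f < f x * ereal (measure M (space M))"
    with fg have "AE x in M. integral\<^sup>L M g < g x * measure M (space M)"
      by eventually_elim (simp add: I)
    with not_AE_integral_less[OF g pos] show False by simp
  qed
  show "\<not> (AE x in M. f x * ereal (measure M (space M)) < ext_integral M f)"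
  proof
    assume "AE x in M. f x * ereal (measure M (space M)) < ext_integral M f"
    \<comment> \<open>Negating both sides reverses the inequality, so the real-valued lemma covers
      this case through \<open>- g\<close>.\<close>
    with fg have "AE x in M. integral\<^sup>L M (\<lambda>x. - g x) < - g x * measure M (space M)"
      by eventually_elim (simp add: I)
    with not_AE_integral_less[of "\<lambda>x. - g x"] g pos show False by simp
  qed
qed

end

text \<open>Passes from the closed interval of integration to the open interval of the conclusion:
  the two endpoints form a null set, so \<open>P\<close> cannot hold only there and on a null
  set.\<close>

lemma emeasure_open_interval_pos:
  fixes a b :: real
  assumes P: "Measurable.pred (lebesgue_on {a..b}) P"
    and not_AE: "\<not> (AE x in lebesgue_on {a..b}. \<not> P x)"
  shows "emeasure lebesgue {c \<in> {a<..<b}. P c} > 0"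
proof (rule ccontr)
  let ?S = "{c \<in> {a<..<b}. P c}"
  \<comment> \<open>Since \<open>emeasure\<close> is also 0 on non-measurable sets,
    \<open>?S\<close> must be shown measurable before the value 0 makes it a null set.\<close>
  have "{x \<in> space (lebesgue_on {a..b}). P x} \<in> sets (lebesgue_on {a..b})"
    using P by (rule predE)
  then have "{x \<in> {a..b}. P x} \<in> sets lebesgue"
    by (subst (asm) sets_restrict_space_iff) auto
  then have "{a<..<b} \<inter> {x \<in> {a..b}. P x} \<in> sets lebesgue"
    by (intro sets.Int) auto
  also have "{a<..<b} \<inter> {x \<in> {a..b}. P x} = ?S" by auto
  finally have S: "?S \<in> sets lebesgue" .
  assume "\<not> emeasure lebesgue ?S > 0"
  with S have "?S \<in> null_sets lebesgue" by (auto simp: null_sets_def)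
  moreover have "{a, b} \<in> null_sets lebesgue"
    by (intro null_sets_completionI finite_imp_null_set_lborel) simp
  ultimately have "AE x in lebesgue. x \<notin> ?S \<union> {a, b}"
    by (intro AE_not_in null_sets.Un)
  then have "AE x in lebesgue. x \<in> {a..b} \<longrightarrow> \<not> P x"
    by eventually_elim auto
  then have "AE x in lebesgue_on {a..b}. \<not> P x"
    by (subst AE_restrict_space_iff) auto
  with not_AE show False by simp
qed

theorem theorem3p1:
  fixes a b :: real and f :: "real \<Rightarrow> ereal"
  assumes "a < b"
    and "ext_integrable (lebesgue_on {a..b}) f"
  shows "emeasure lebesgue
           {c \<in> {a<..<b}. f c * ereal (b - a) \<le> ext_integral (lebesgue_on {a..b}) f} > 0
       \<and> emeasure lebesgue
           {c \<in> {a<..<b}. ext_integral (lebesgue_on {a..b}) f \<le> f c * ereal (b - a)} > 0"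
proof -
  let ?M = "lebesgue_on {a..b}"
  have em: "emeasure ?M (space ?M) = ennreal (b - a)"
    using assms(1) by (simp add: emeasure_restrict_space)
  interpret finite_measure ?M
    by standard (simp only: em ennreal_neq_top infinity_ennreal_def not_False_eq_True)
  have m: "measure ?M (space ?M) = b - a"
    using em assms(1) by (simp add: measure_def)
  have pos: "emeasure ?M (space ?M) \<noteq> 0"
    using em assms(1) by simp
  have [measurable]: "f \<in> borel_measurable ?M"
    using assms(2) by (simp add: ext_integrable_def)
  \<comment> \<open>With total mass \<open>b - a\<close>, the negation of each non-strict inequality
    is one of the two strict ones already excluded.\<close>
  show ?thesis
    using ext_integral_not_AE_less[OF assms(2) pos]
    by (intro conjI emeasure_open_interval_pos) (simp_all only: m not_le, measurable)
qed

end
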